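(* Let $M$ be a smooth connected finite-dimensional manifold and let $\Phi:S^1\times M\to M$ be a smooth action of the Lie group $S^1$ on $M$. Let $F=\mathrm{Fix}\,\Phi$ be its set of fixed points, let $K\subset S^1$ be the ineffectivity kernel of the action, i.e. the kernel of the induced homomorphism $S^1\to\mathrm{Diff}(M)$, and let $$Z_{\mathrm{id}}=\{\alpha\in C^{\infty}(M,S^1) \mid \Phi(\alpha(z),z)=z \text{ for all } z\in M\}.$$ If the action $\Phi$ is non-trivial, then $\mathrm{Int}\,F=\emptyset$ and $Z_{\mathrm{id}}$ consists of the constant mappings $M\to K\subset S^1$. Consequently, $Z_{\mathrm{id}}$ is isomorphic to $K$ and is a finite cyclic group.
   Context: Smooth means $C^\infty$. A point $z\in M$ is fixed if $\Phi(g,z)=z$ for all $g\in S^1$. $\mathrm{Int}\,F$ is the interior of $F$ in $M$. The action is trivial if every point of $M$ is fixed. $\mathrm{Diff}(M)$ is the group of diffeomorphisms of $M$. $C^{\infty}(M,S^1)$ is a group under pointwise multiplication, and $Z_{\mathrm{id}}$ is a subgroup of it. *)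

theory Defs
  imports "HOL-Analysis.Analysis" "HOL-Algebra.Elementary_Groups" "HOL-Algebra.Bij"
begin

section \<open>Smooth maps between normed spaces\<close>

text \<open>
  The class \<open>C\<^sup>k\<close> on an open set, by iterated directional derivatives of the Frechet derivative.
  On a finite-dimensional domain, the only case used below, continuity of the derivative in
  every fixed direction is the same as continuity in operator norm. The definition is only
  meant for open \<open>S\<close>.
\<close>

primrec Ck_on :: "nat \<Rightarrow> 'a::real_normed_vector set \<Rightarrow> ('a \<Rightarrow> 'b::real_normed_vector) \<Rightarrow> bool" where
  "Ck_on 0 S f \<longleftrightarrow> continuous_on S f"
| "Ck_on (Suc k) S f \<longleftrightarrow>
     (\<forall>x\<in>S. f differentiable (at x)) \<and>
     (\<forall>v. Ck_on k S (\<lambda>x. frechet_derivative f (at x) v))"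

definition smooth_on :: "'a::real_normed_vector set \<Rightarrow> ('a \<Rightarrow> 'b::real_normed_vector) \<Rightarrow> bool" where
  "smooth_on S f \<longleftrightarrow> (\<forall>k. Ck_on k S f)"

section \<open>Smooth manifolds\<close>

text \<open>
  A chart is a domain together with a map to the model space; only the values on the domain
  matter, and its inverse is \<open>inv_into U \<phi>\<close>.
\<close>

type_synonym ('a, 'e) chart = "'a set \<times> ('a \<Rightarrow> 'e)"

definition is_chart :: "'a topology \<Rightarrow> ('a, 'e::real_normed_vector) chart \<Rightarrow> bool" where
  "is_chart X = (\<lambda>(U, \<phi>). openin X U \<and> open (\<phi> ` U) \<and>
     homeomorphic_map (subtopology X U) (top_of_set (\<phi> ` U)) \<phi>)"

definition smooth_transition ::
    "('a, 'e::real_normed_vector) chart \<Rightarrow> ('a, 'e) chart \<Rightarrow> bool" where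
  "smooth_transition = (\<lambda>(U, \<phi>) (V, \<psi>). smooth_on (\<phi> ` (U \<inter> V)) (\<psi> \<circ> inv_into U \<phi>))"

text \<open>
  Manifolds are without boundary, Hausdorff and second countable, and are modelled on a
  finite-dimensional space \<open>'e\<close>. A normed space is used in place of \<open>real ^ 'n\<close> (or a
  \<open>euclidean_space\<close>) because these types have positive dimension, whereas \<open>'e\<close> may be
  zero-dimensional. The sort \<open>banach\<close> is no restriction, since finite-dimensional normed spaces
  are complete. The atlas need not be maximal; smoothness of maps does not depend on the choice
  of atlas within a smooth structure.
\<close>

definition smooth_manifold :: "'a topology \<Rightarrow> ('a, 'e::banach) chart set \<Rightarrow> bool" where
  "smooth_manifold X A \<longleftrightarrow>
     (\<exists>B::'e set. finite B \<and> span B = UNIV) \<and>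
     Hausdorff_space X \<and> second_countable X \<and>
     (\<forall>c\<in>A. is_chart X c) \<and>
     (\<Union>c\<in>A. fst c) = topspace X \<and>
     (\<forall>c\<in>A. \<forall>d\<in>A. smooth_transition c d)"

definition smooth_map ::
    "'a topology \<Rightarrow> ('a, 'e::real_normed_vector) chart set \<Rightarrow>
     'b topology \<Rightarrow> ('b, 'f::real_normed_vector) chart set \<Rightarrow> ('a \<Rightarrow> 'b) \<Rightarrow> bool" where
  "smooth_map X A Y B f \<longleftrightarrow> continuous_map X Y f \<and>
     (\<forall>(U, \<phi>)\<in>A. \<forall>(V, \<psi>)\<in>B. smooth_on (\<phi> ` (U \<inter> f -` V)) (\<psi> \<circ> f \<circ> inv_into U \<phi>))"

definition product_atlas ::
    "('a, 'e) chart set \<Rightarrow> ('b, 'f) chart set \<Rightarrow> ('a \<times> 'b, 'e \<times> 'f) chart set" where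
  "product_atlas A B = {(U \<times> V, map_prod \<phi> \<psi>) | U \<phi> V \<psi>. (U, \<phi>) \<in> A \<and> (V, \<psi>) \<in> B}"

text \<open>Diffeomorphisms are extensional functions on the manifold, as in \<^const>\<open>BijGroup\<close>.\<close>

definition Diff_group :: "'a topology \<Rightarrow> ('a, 'e::real_normed_vector) chart set \<Rightarrow> ('a \<Rightarrow> 'a) monoid"
  where
  "Diff_group X A = BijGroup (topspace X)
     \<lparr>carrier := {f \<in> Bij (topspace X).
        smooth_map X A X A f \<and> smooth_map X A X A (inv_into (topspace X) f)}\<rparr>"

section \<open>The Lie group \<open>S\<^sup>1\<close>\<close>

definition circle_group :: "complex monoid" where
  "circle_group = \<lparr>carrier = sphere 0 1, mult = (*), one = 1\<rparr>"

definition circle_top :: "complex topology" where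
  "circle_top = top_of_set (sphere 0 1)"

text \<open>The charts are the branches of the argument function.\<close>

definition circle_atlas :: "(complex, real) chart set" where
  "circle_atlas =
     range (\<lambda>a. (cis ` {a<..<a + 2 * pi}, inv_into {a<..<a + 2 * pi} cis))"

text \<open>\<open>C\<^sup>\<infinity>(M, S\<^sup>1)\<close> with pointwise multiplication\<close>

definition smooth_circle_maps ::
    "'a topology \<Rightarrow> ('a, 'e::real_normed_vector) chart set \<Rightarrow> ('a \<Rightarrow> complex) monoid" where
  "smooth_circle_maps X A =
     \<lparr>carrier = {\<alpha> \<in> extensional (topspace X). smooth_map X A circle_top circle_atlas \<alpha>},
      mult = (\<lambda>\<alpha> \<beta>. \<lambda>z\<in>topspace X. \<alpha> z * \<beta> z),
      one = (\<lambda>z\<in>topspace X. 1)\<rparr>"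

section \<open>Smooth circle actions\<close>

definition smooth_circle_action ::
    "'a topology \<Rightarrow> ('a, 'e::real_normed_vector) chart set \<Rightarrow> (complex \<times> 'a \<Rightarrow> 'a) \<Rightarrow> bool" where
  "smooth_circle_action X A \<Phi> \<longleftrightarrow>
     smooth_map (prod_topology circle_top X) (product_atlas circle_atlas A) X A \<Phi> \<and>
     (\<forall>z\<in>topspace X. \<Phi> (1, z) = z) \<and>
     (\<forall>g\<in>carrier circle_group. \<forall>h\<in>carrier circle_group. \<forall>z\<in>topspace X.
        \<Phi> (g * h, z) = \<Phi> (g, \<Phi> (h, z)))"

definition fixed_points :: "'a topology \<Rightarrow> (complex \<times> 'a \<Rightarrow> 'a) \<Rightarrow> 'a set" where
  "fixed_points X \<Phi> = {z \<in> topspace X. \<forall>g\<in>carrier circle_group. \<Phi> (g, z) = z}"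

definition trivial_action :: "'a topology \<Rightarrow> (complex \<times> 'a \<Rightarrow> 'a) \<Rightarrow> bool" where
  "trivial_action X \<Phi> \<longleftrightarrow> (\<forall>z\<in>topspace X. z \<in> fixed_points X \<Phi>)"

definition ineffectivity_kernel ::
    "'a topology \<Rightarrow> ('a, 'e::real_normed_vector) chart set \<Rightarrow> (complex \<times> 'a \<Rightarrow> 'a) \<Rightarrow> complex set"
  where
  "ineffectivity_kernel X A \<Phi> =
     kernel circle_group (Diff_group X A) (\<lambda>g. \<lambda>z\<in>topspace X. \<Phi> (g, z))"

definition Z_id ::
    "'a topology \<Rightarrow> ('a, 'e::real_normed_vector) chart set \<Rightarrow> (complex \<times> 'a \<Rightarrow> 'a) \<Rightarrow>
     ('a \<Rightarrow> complex) set" where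
  "Z_id X A \<Phi> = {\<alpha> \<in> carrier (smooth_circle_maps X A). \<forall>z\<in>topspace X. \<Phi> (\<alpha> z, z) = z}"

end

theory Submission
  imports Defs
begin

text \<open>
  Everything rests on one fact: an element \<open>g\<close> of finite order \<open>n\<close> in the circle whose fixed point
  set contains a nonempty open set acts trivially. Indeed \<open>I = Int (Fix g)\<close> is closed. At a limit
  point \<open>z\<close> of \<open>I\<close>, all powers of \<open>g\<close> fix \<open>z\<close> and, by continuity of the derivative, have derivative
  \<open>id\<close> there. In a chart \<open>\<phi>\<close> at \<open>z\<close> the sum \<open>H(w) = \<Sum>k<n. \<phi>(g\<^sup>k w)\<close> therefore has derivative
  \<open>n id\<close> and is injective near \<open>z\<close>, whereas \<open>H(g w) = H(w)\<close>; hence \<open>g w = w\<close> near \<open>z\<close>, that is,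
  \<open>z \<in> I\<close>. So \<open>I\<close> is open and closed, and \<open>M\<close> is connected. This is Bochner's averaging argument, with
  the finite cyclic group generated by \<open>g\<close> in place of the circle.
  (\<open>C1_strictly_differentiable\<close>, \<open>sum_locally_injective\<close>, \<open>finite_order_fixes_everything\<close>)

  The second ingredient is topological (\<open>no_small_stabilizers\<close>): if \<open>z\<close> is not fixed, then there is
  an \<open>\<epsilon>\<close> such that no stabilizer of a point near \<open>z\<close> contains an element other than \<open>1\<close> at distance
  less than \<open>\<epsilon>\<close> from \<open>1\<close>, because the powers of an element close to \<open>1\<close> come close to every point
  of the circle. Consequently the stabilizer of \<open>z\<close> consists of roots of unity, and the ineffectivity
  kernel \<open>K\<close> is finite.

  If \<open>Int F\<close> were nonempty, every root of unity would fix an open set and hence lie in the finite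
  set \<open>K\<close>, which is absurd. If \<open>\<alpha>\<close> is a continuous map with \<open>\<alpha>(x)\<close> in the stabilizer of \<open>x\<close> for all
  \<open>x\<close>, and \<open>z\<close> is not fixed, let \<open>n\<close> be the order of \<open>\<alpha>(z)\<close>. For \<open>x\<close> near \<open>z\<close> the element \<open>\<alpha>(x)\<^sup>n\<close>
  stabilizes \<open>x\<close> and is near \<open>1\<close>, so it equals \<open>1\<close>; the \<open>n\<close>-th roots of unity being discrete, \<open>\<alpha>\<close> is
  constant near \<open>z\<close>. Thus \<open>\<alpha>(z)\<close> fixes an open set and lies in \<open>K\<close>. Since \<open>K\<close> is closed and the
  nonfixed points are dense, \<open>\<alpha>\<close> maps \<open>M\<close> to \<open>K\<close>, and as \<open>M\<close> is connected and \<open>K\<close> finite, \<open>\<alpha>\<close> is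
  constant. Finally, a finite subgroup of the circle with \<open>n\<close> elements is the group of \<open>n\<close>-th roots
  of unity, hence cyclic.
\<close>

section \<open>Strict differentiability in finite dimensions\<close>

text \<open>
  The norm of the combination is continuous in the coefficients, and positive on the compact set of
  coefficient vectors with absolute sum \<open>1\<close>; it attains a positive minimum there, and the
  general case follows by scaling.
\<close>
lemma coefficients_bounded_by_norm:
  fixes B :: "'e::real_normed_vector set"
  assumes fin: "finite B" and ind: "independent B"
  obtains c where "c > 0" "\<And>u. c * (\<Sum>b\<in>B. \<bar>u b\<bar>) \<le> norm (\<Sum>b\<in>B. u b *\<^sub>R b)"
proof -
  \<comment> \<open>Coefficients outside \<open>B\<close> are set to \<open>0\<close>, so that \<open>P\<close> is compact in the full function space.\<close>
  define P :: "('e \<Rightarrow> real) set" where "P = (\<Pi>\<^sub>E b\<in>UNIV. if b \<in> B then {-1..1} else {0})"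
  define S where "S = P \<inter> {u. (\<Sum>b\<in>B. \<bar>u b\<bar>) = 1}"
  define f where "f = (\<lambda>u::'e \<Rightarrow> real. norm (\<Sum>b\<in>B. u b *\<^sub>R b))"
  have "compactin (product_topology (\<lambda>_. euclideanreal) UNIV) P"
    unfolding P_def by (subst compactin_PiE) auto
  hence "compact P"
    by (simp add: euclidean_product_topology)
  moreover have "closed {u::'e \<Rightarrow> real. (\<Sum>b\<in>B. \<bar>u b\<bar>) = 1}"
    by (intro closed_Collect_eq continuous_intros)
       (auto intro: continuous_on_product_coordinates)
  ultimately have compS: "compact S"
    unfolding S_def by blast
  have contf: "continuous_on S f"
    unfolding f_def by (intro continuous_intros) (auto intro: continuous_on_product_coordinates continuous_on_subset)
  have pos: "f u > 0" if "u \<in> S" for u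
  proof -
    have "\<exists>b\<in>B. u b \<noteq> 0"
      using that unfolding S_def by (metis (mono_tags, lifting) IntE abs_zero mem_Collect_eq sum.neutral zero_neq_one)
    hence "(\<Sum>b\<in>B. u b *\<^sub>R b) \<noteq> 0"
      using ind fin by (auto simp: independent_explicit_finite_subsets)
    thus ?thesis by (simp add: f_def)
  qed
  obtain c where c: "c > 0" "\<And>u. u \<in> S \<Longrightarrow> c \<le> f u"
  proof (cases "S = {}")
    case True
    thus ?thesis using that[of 1] by simp
  next
    case False
    then obtain u where "u \<in> S" "\<And>v. v \<in> S \<Longrightarrow> f u \<le> f v"
      using continuous_attains_inf[OF compS _ contf] by blast
    thus ?thesis using that[of "f u"] pos by blast
  qed
  show ?thesis
  proof (rule that[OF c(1)])
    fix u :: "'e \<Rightarrow> real"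
    define t where "t = (\<Sum>b\<in>B. \<bar>u b\<bar>)"
    show "c * (\<Sum>b\<in>B. \<bar>u b\<bar>) \<le> norm (\<Sum>b\<in>B. u b *\<^sub>R b)"
    proof (cases "t = 0")
      case True
      thus ?thesis by (simp add: t_def)
    next
      case False
      hence t: "t > 0"
        unfolding t_def by (auto simp: less_le sum_nonneg)
      define v where "v = (\<lambda>b. if b \<in> B then u b / t else 0)"
      have "\<bar>u b\<bar> \<le> t" if "b \<in> B" for b
        unfolding t_def using fin that by (intro member_le_sum) auto
      hence "v \<in> P"
        using t by (auto simp: P_def v_def abs_le_iff field_simps) (smt (verit))
      moreover have "(\<Sum>b\<in>B. \<bar>v b\<bar>) = 1"
        using t by (simp add: v_def abs_divide sum_divide_distrib[symmetric] t_def[symmetric])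
      ultimately have "c \<le> f v"
        using c(2) by (auto simp: S_def)
      also have "(\<Sum>b\<in>B. v b *\<^sub>R b) = (1 / t) *\<^sub>R (\<Sum>b\<in>B. u b *\<^sub>R b)"
        by (simp add: v_def scaleR_sum_right)
      hence "f v = norm (\<Sum>b\<in>B. u b *\<^sub>R b) / t"
        using t by (simp add: f_def)
      finally show ?thesis
        using t by (simp add: field_simps t_def)
    qed
  qed
qed

text \<open>
  This turns continuity of the derivative in each fixed direction, which is what \<^const>\<open>Ck_on\<close>
  provides, into continuity in operator norm.
\<close>
lemma operator_bounded_by_values_on_spanning_set:
  fixes B0 :: "'e::real_normed_vector set"
  assumes "finite B0" "span B0 = UNIV"
  obtains B C where "finite B" "C > 0"
    "\<And>(L :: 'e \<Rightarrow> 'f::real_normed_vector) v. linear L \<Longrightarrow> norm (L v) \<le> C * (\<Sum>b\<in>B. norm (L b)) * norm v"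
proof -
  obtain B where B: "B \<subseteq> B0" "independent B" "span B = UNIV"
    using maximal_independent_subset[of B0] assms(2) by (metis span_mono span_span subset_UNIV subset_antisym)
  have fin: "finite B"
    using B(1) assms(1) finite_subset by blast
  obtain c where c: "c > 0" "\<And>u. c * (\<Sum>b\<in>B. \<bar>u b\<bar>) \<le> norm (\<Sum>b\<in>B. u b *\<^sub>R b)"
    by (rule coefficients_bounded_by_norm[OF fin B(2)]) (rule that)
  show ?thesis
  proof (rule that[OF fin, of "1 / c"])
    show "1 / c > 0" using c by simp
    fix L :: "'e \<Rightarrow> 'f" and v :: 'e
    assume L: "linear L"
    have "v \<in> range (\<lambda>u. \<Sum>b\<in>B. u b *\<^sub>R b)"
      using B(3) span_finite[OF fin] by simp
    then obtain u where u: "v = (\<Sum>b\<in>B. u b *\<^sub>R b)" by blast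
    have ub: "\<bar>u b\<bar> \<le> norm v / c" if "b \<in> B" for b
    proof -
      have "\<bar>u b\<bar> \<le> (\<Sum>b\<in>B. \<bar>u b\<bar>)"
        using fin that by (intro member_le_sum) auto
      also have "\<dots> \<le> norm v / c"
        using c(1) c(2)[of u] u by (simp add: field_simps)
      finally show ?thesis .
    qed
    have "L v = (\<Sum>b\<in>B. u b *\<^sub>R L b)"
      unfolding u by (simp add: linear_sum[OF L] linear_cmul[OF L])
    hence "norm (L v) \<le> (\<Sum>b\<in>B. \<bar>u b\<bar> * norm (L b))"
      by (metis (no_types, lifting) norm_scaleR norm_sum sum.cong)
    also have "\<dots> \<le> (\<Sum>b\<in>B. norm v / c * norm (L b))"
      by (intro sum_mono mult_right_mono ub) auto
    also have "\<dots> = 1 / c * (\<Sum>b\<in>B. norm (L b)) * norm v"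
      by (simp add: sum_distrib_left[symmetric] sum_divide_distrib[symmetric])
    finally show "norm (L v) \<le> 1 / c * (\<Sum>b\<in>B. norm (L b)) * norm v" .
  qed
qed

text \<open>
  The mean value inequality for \<open>f - Df(p)\<close>, whose derivative is small near \<open>p\<close> in operator norm.
\<close>
lemma C1_strictly_differentiable:
  fixes f :: "'e::real_normed_vector \<Rightarrow> 'f::real_normed_vector"
  assumes "finite (B0::'e set)" "span B0 = UNIV"
    and S: "open S" "p \<in> S" and f: "Ck_on (Suc 0) S f" and "\<epsilon> > 0"
  shows "\<exists>r>0. \<forall>x\<in>ball p r. \<forall>y\<in>ball p r.
       norm (f x - f y - frechet_derivative f (at p) (x - y)) \<le> \<epsilon> * norm (x - y)"
proof -
  let ?D = "\<lambda>x. frechet_derivative f (at x)"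
  obtain B C where B: "finite B" "C > 0"
    and bound: "\<And>(L :: 'e \<Rightarrow> 'f) v. linear L \<Longrightarrow> norm (L v) \<le> C * (\<Sum>b\<in>B. norm (L b)) * norm v"
    using operator_bounded_by_values_on_spanning_set[OF assms(1,2)] by metis
  have der: "(f has_derivative ?D x) (at x)" if "x \<in> S" for x
    using f that by (simp add: frechet_derivative_works)
  have "continuous_on S (\<lambda>x. \<Sum>b\<in>B. norm (?D x b - ?D p b))"
    using f by (intro continuous_intros) auto
  hence "isCont (\<lambda>x. \<Sum>b\<in>B. norm (?D x b - ?D p b)) p"
    using S by (simp add: continuous_on_eq_continuous_at)
  hence "((\<lambda>x. \<Sum>b\<in>B. norm (?D x b - ?D p b)) \<longlongrightarrow> (\<Sum>b\<in>B. norm (?D p b - ?D p b))) (nhds p)"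
    unfolding isCont_def
    using tendsto_at_iff_tendsto_nhds[of "\<lambda>x. \<Sum>b\<in>B. norm (?D x b - ?D p b)" p] by blast
  hence "\<forall>\<^sub>F x in nhds p. (\<Sum>b\<in>B. norm (?D x b - ?D p b)) < \<epsilon> / C"
    by (rule order_tendstoD(2)) (use \<open>\<epsilon> > 0\<close> B(2) in simp)
  moreover have "\<forall>\<^sub>F x in nhds p. x \<in> S"
    using S by (simp add: eventually_nhds_in_open)
  ultimately have "\<forall>\<^sub>F x in nhds p. x \<in> S \<and> (\<Sum>b\<in>B. norm (?D x b - ?D p b)) < \<epsilon> / C"
    by eventually_elim auto
  then obtain r where r: "r > 0"
    "\<And>x. x \<in> ball p r \<Longrightarrow> x \<in> S \<and> (\<Sum>b\<in>B. norm (?D x b - ?D p b)) < \<epsilon> / C"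
    unfolding eventually_nhds_metric by (auto simp: dist_commute)
  show ?thesis
  proof (intro exI[of _ r] conjI ballI r(1))
    fix x y assume xy: "x \<in> ball p r" "y \<in> ball p r"
    have linp: "bounded_linear (?D p)"
      using der[OF S(2)] has_derivative_bounded_linear by blast
    have der': "((\<lambda>x. f x - ?D p x) has_derivative (\<lambda>v. ?D x v - ?D p v)) (at x within ball p r)"
      if "x \<in> ball p r" for x
      using der r(2)[OF that] linp
      by (intro has_derivative_diff bounded_linear_imp_has_derivative) (auto intro: has_derivative_at_withinI)
    have "onorm (\<lambda>v. ?D x v - ?D p v) \<le> \<epsilon>" if x: "x \<in> ball p r" for x
    proof (rule onorm_bound)
      fix v
      have "linear (\<lambda>v. ?D x v - ?D p v)"
        using der'[OF x] has_derivative_bounded_linear bounded_linear.linear by blast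
      hence "norm (?D x v - ?D p v) \<le> C * (\<Sum>b\<in>B. norm (?D x b - ?D p b)) * norm v"
        by (rule bound)
      also have "\<dots> \<le> C * (\<epsilon> / C) * norm v"
        using r(2)[OF x] B(2) by (intro mult_right_mono mult_left_mono) auto
      finally show "norm (?D x v - ?D p v) \<le> \<epsilon> * norm v"
        using B(2) by simp
    qed (use \<open>\<epsilon> > 0\<close> in simp)
    from differentiable_bound[OF convex_ball der' this xy]
    have "norm (f x - ?D p x - (f y - ?D p y)) \<le> \<epsilon> * norm (x - y)" by simp
    moreover have "?D p (x - y) = ?D p x - ?D p y"
      using linp by (simp add: bounded_linear.linear linear_diff)
    hence "f x - f y - ?D p (x - y) = f x - ?D p x - (f y - ?D p y)"
      by simp
    ultimately show "norm (f x - f y - ?D p (x - y)) \<le> \<epsilon> * norm (x - y)"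
      by (simp only:)
  qed
qed

text \<open>
  Each \<open>f k\<close> differs from the identity by a map with Lipschitz constant \<open>1/2\<close> near \<open>p\<close>, so the sum
  differs from \<open>n id\<close> by a map with Lipschitz constant \<open>n/2\<close>.
\<close>
lemma sum_locally_injective:
  fixes f :: "nat \<Rightarrow> 'e::real_normed_vector \<Rightarrow> 'e"
  assumes "finite (B0::'e set)" "span B0 = UNIV" and "n > 0"
    and S: "\<And>k. k < n \<Longrightarrow> open (S k)" "\<And>k. k < n \<Longrightarrow> p \<in> S k"
    and f: "\<And>k. k < n \<Longrightarrow> Ck_on (Suc 0) (S k) (f k)"
    and D: "\<And>k v. k < n \<Longrightarrow> frechet_derivative (f k) (at p) v = v"
  shows "\<exists>r>0. inj_on (\<lambda>x. \<Sum>k<n. f k x) (ball p r)"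
proof -
  have "\<exists>r>0. \<forall>x\<in>ball p r. \<forall>y\<in>ball p r. norm (f k x - f k y - (x - y)) \<le> 1/2 * norm (x - y)"
    if "k < n" for k
    using C1_strictly_differentiable[OF assms(1,2) S(1) S(2) f, OF that that that, of "1/2"]
    unfolding D[OF that] by simp
  then obtain r where r: "\<And>k. k < n \<Longrightarrow> r k > 0"
    "\<And>k x y. k < n \<Longrightarrow> x \<in> ball p (r k) \<Longrightarrow> y \<in> ball p (r k) \<Longrightarrow>
        norm (f k x - f k y - (x - y)) \<le> 1/2 * norm (x - y)"
    by metis
  define R where "R = Min (r ` {..<n})"
  have R: "R > 0" "\<And>k. k < n \<Longrightarrow> R \<le> r k"
    unfolding R_def using r(1) \<open>n > 0\<close> by (auto simp: Min_gr_iff lessThan_empty_iff)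
  show ?thesis
  proof (intro exI[of _ R] conjI R(1) inj_onI)
    fix x y assume xy: "x \<in> ball p R" "y \<in> ball p R" and eq: "(\<Sum>k<n. f k x) = (\<Sum>k<n. f k y)"
    have "(\<Sum>k<n. f k x - f k y - (x - y)) = - (real n *\<^sub>R (x - y))"
      using eq by (simp add: sum_subtractf sum_constant_scaleR scaleR_diff_right)
    hence "real n * norm (x - y) = norm (\<Sum>k<n. f k x - f k y - (x - y))"
      by simp
    also have "\<dots> \<le> (\<Sum>k<n. 1/2 * norm (x - y))"
      using R(2) xy by (intro sum_norm_le r(2)) fastforce+
    finally have "real n * norm (x - y) \<le> real n * (norm (x - y) / 2)" by simp
    hence "norm (x - y) \<le> norm (x - y) / 2"
      using \<open>n > 0\<close> by simp
    thus "x = y" by simp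
  qed
qed

section \<open>Charts and slices of the action\<close>

lemma chart_inj_on:
  assumes "is_chart X (U, \<phi>)"
  shows "inj_on \<phi> U"
proof -
  have "topspace (subtopology X U) = U"
    using assms openin_subset unfolding is_chart_def by fastforce
  thus ?thesis
    using assms homeomorphic_imp_injective_map unfolding is_chart_def by fastforce
qed

lemma chart_open_image:
  assumes c: "is_chart X (U, \<phi>)" and W: "openin X W" "W \<subseteq> U"
  shows "open (\<phi> ` W)"
proof -
  have "openin (subtopology X U) W"
    using W by (metis inf.absorb_iff2 openin_subtopology_Int2)
  moreover have "open_map (subtopology X U) (top_of_set (\<phi> ` U)) \<phi>"
    using c homeomorphic_imp_open_map unfolding is_chart_def by blast
  ultimately have "openin (top_of_set (\<phi> ` U)) (\<phi> ` W)"
    by (simp add: open_map_def)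
  thus ?thesis
    using c openin_open_trans unfolding is_chart_def by blast
qed

lemma chart_open_preimage:
  assumes c: "is_chart X (U, \<phi>)" and "open T"
  shows "openin X {w \<in> U. \<phi> w \<in> T}"
proof -
  have U: "openin X U" using c by (simp add: is_chart_def)
  have top: "topspace (subtopology X U) = U"
    using U openin_subset by fastforce
  have "continuous_map (subtopology X U) (top_of_set (\<phi> ` U)) \<phi>"
    using c homeomorphic_imp_continuous_map unfolding is_chart_def by blast
  hence "openin (subtopology X U) {w \<in> topspace (subtopology X U). \<phi> w \<in> \<phi> ` U \<inter> T}"
    by (rule openin_continuous_map_preimage) (simp add: assms(2) openin_open_Int)
  hence "openin X {w \<in> topspace (subtopology X U). \<phi> w \<in> \<phi> ` U \<inter> T}"
    using U openin_trans_full by blast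
  moreover have "{w \<in> topspace (subtopology X U). \<phi> w \<in> \<phi> ` U \<inter> T} = {w \<in> U. \<phi> w \<in> T}"
    unfolding top by auto
  ultimately show ?thesis by simp
qed

text \<open>
  Nothing is assumed about \<open>f\<close> outside \<open>S\<close>, but openness of \<open>S\<close> makes the derivatives on \<open>S\<close> those
  of the constant.
\<close>
lemma Ck_on_constant:
  assumes "open S" "\<And>x. x \<in> S \<Longrightarrow> f x = c"
  shows "Ck_on k S f"
  using assms(2)
proof (induction k arbitrary: f c)
  case 0
  have "continuous_on S f \<longleftrightarrow> continuous_on S (\<lambda>x. c)"
    using 0 by (intro continuous_on_cong) simp_all
  thus ?case by simp
next
  case (Suc k)
  have der: "(f has_derivative (\<lambda>v. 0)) (at x)" if "x \<in> S" for x
    by (rule has_derivative_transform_within_open[OF has_derivative_const[of c] assms(1) that])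
       (simp add: Suc.prems)
  have "frechet_derivative f (at x) v = 0" if "x \<in> S" for x v
    using frechet_derivative_at[OF der[OF that]] by metis
  hence "Ck_on k S (\<lambda>x. frechet_derivative f (at x) v)" for v
    by (rule Suc.IH)
  thus ?case
    using der by (auto simp: differentiable_def)
qed

lemma cis_Arg_sphere:
  assumes "g \<in> sphere 0 1"
  shows "cis (Arg g) = g"
proof -
  have "g \<noteq> 0" using assms by auto
  thus ?thesis using assms by (simp add: cis_Arg sgn_div_norm)
qed

text \<open>
  The map is the coordinate expression of \<open>\<Phi>\<close> in a product chart, with the circle coordinate held fixed,
  so its directional derivatives are those of \<open>\<Phi>\<close> in directions \<open>(0, v)\<close>.
\<close>
lemma slice_C1:
  fixes A :: "('a, 'e::banach) chart set"
  assumes act: "smooth_circle_action X A \<Phi>" and g: "g \<in> sphere 0 1"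
    and c: "(U, \<phi>) \<in> A" "is_chart X (U, \<phi>)"
  shows "Ck_on (Suc 0) (\<phi> ` (U \<inter> (\<lambda>z. \<Phi> (g, z)) -` U)) (\<lambda>x. \<phi> (\<Phi> (g, inv_into U \<phi> x)))"
proof -
  define S where "S = \<phi> ` (U \<inter> (\<lambda>z. \<Phi> (g, z)) -` U)"
  \<comment> \<open>The branch of the argument is centred at \<open>g\<close>, so that its domain contains \<open>g\<close>.\<close>
  define I where "I = {Arg g - pi<..<Arg g - pi + 2 * pi}"
  define \<theta> where "\<theta> = inv_into I cis"
  define V where "V = cis ` I"
  define G where "G = \<phi> \<circ> \<Phi> \<circ> inv_into (V \<times> U) (map_prod \<theta> \<phi>)"
  define \<Omega> where "\<Omega> = map_prod \<theta> \<phi> ` ((V \<times> U) \<inter> \<Phi> -` U)"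
  have "cis (Arg g) = g"
    using g by (rule cis_Arg_sphere)
  hence gV: "g \<in> V"
    by (auto simp: V_def I_def intro!: image_eqI[of _ _ "Arg g"])
  have "(V, \<theta>) \<in> circle_atlas"
    unfolding circle_atlas_def V_def \<theta>_def I_def by blast
  hence "(V \<times> U, map_prod \<theta> \<phi>) \<in> product_atlas circle_atlas A"
    using c unfolding product_atlas_def by blast
  hence "smooth_on \<Omega> G"
    using act c(1) unfolding smooth_circle_action_def smooth_map_def \<Omega>_def G_def by fastforce
  hence "Ck_on (Suc 0) \<Omega> G"
    unfolding smooth_on_def by blast
  hence G: "\<And>q. q \<in> \<Omega> \<Longrightarrow> (G has_derivative frechet_derivative G (at q)) (at q)"
    "\<And>v. continuous_on \<Omega> (\<lambda>q. frechet_derivative G (at q) v)"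
    by (auto simp: frechet_derivative_works)
  have inj: "inj_on (map_prod \<theta> \<phi>) (V \<times> U)"
    unfolding V_def \<theta>_def by (intro map_prod_inj_on inj_on_inv_into chart_inj_on[OF c(2)]) auto
  have Geq: "G (\<theta> g, x) = \<phi> (\<Phi> (g, inv_into U \<phi> x))" if "x \<in> \<phi> ` U" for x
  proof -
    have "(\<theta> g, x) = map_prod \<theta> \<phi> (g, inv_into U \<phi> x)"
      using that by (simp add: f_inv_into_f)
    moreover have "(g, inv_into U \<phi> x) \<in> V \<times> U"
      using that gV by (simp add: inv_into_into)
    ultimately have "inv_into (V \<times> U) (map_prod \<theta> \<phi>) (\<theta> g, x) = (g, inv_into U \<phi> x)"
      using inv_into_f_f[OF inj, of "(g, inv_into U \<phi> x)"] by argo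
    thus ?thesis
      by (simp add: G_def)
  qed
  have \<Omega>: "(\<theta> g, x) \<in> \<Omega>" if "x \<in> S" for x
    using that gV unfolding S_def \<Omega>_def by force
  have openU: "open (\<phi> ` U)"
    using c(2) by (simp add: is_chart_def)
  have der: "((\<lambda>x. \<phi> (\<Phi> (g, inv_into U \<phi> x))) has_derivative
      (\<lambda>v. frechet_derivative G (at (\<theta> g, x)) (0, v))) (at x)" if x: "x \<in> S" for x
  proof (rule has_derivative_transform_within_open[OF _ openU])
    have "((\<lambda>x. (\<theta> g, x)) has_derivative (\<lambda>v. (0, v))) (at x)"
      by (auto intro!: derivative_eq_intros)
    from has_derivative_compose[OF this G(1)[OF \<Omega>[OF x]]]
    show "((\<lambda>x. G (\<theta> g, x)) has_derivative (\<lambda>v. frechet_derivative G (at (\<theta> g, x)) (0, v))) (at x)" .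
    show "x \<in> \<phi> ` U" using x by (auto simp: S_def)
  qed (simp add: Geq)
  have cont: "continuous_on S (\<lambda>x. frechet_derivative G (at (\<theta> g, x)) (0, v))" for v
    by (rule continuous_on_compose2[OF G(2)]) (auto intro!: continuous_intros \<Omega>)
  have "continuous_on S (\<lambda>x. frechet_derivative (\<lambda>x. \<phi> (\<Phi> (g, inv_into U \<phi> x))) (at x) v)" for v
    using continuous_on_eq[OF cont] frechet_derivative_at[OF der] by metis
  thus ?thesis
    using der unfolding S_def[symmetric] by (auto simp: differentiable_def)
qed

section \<open>Stabilizers of a continuous circle action\<close>

locale circle_action =
  fixes X :: "'a topology" and \<Phi> :: "complex \<times> 'a \<Rightarrow> 'a"
  assumes Hausdorff: "Hausdorff_space X"
    and continuous: "continuous_map (prod_topology circle_top X) X \<Phi>"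
    and one: "z \<in> topspace X \<Longrightarrow> \<Phi> (1, z) = z"
    and mult: "g \<in> sphere 0 1 \<Longrightarrow> h \<in> sphere 0 1 \<Longrightarrow> z \<in> topspace X \<Longrightarrow> \<Phi> (g * h, z) = \<Phi> (g, \<Phi> (h, z))"
begin

lemma continuous_slice: "g \<in> sphere 0 1 \<Longrightarrow> continuous_map X X (\<lambda>z. \<Phi> (g, z))"
  using continuous_map_compose[OF _ continuous, of X "\<lambda>z. (g, z)"]
  by (simp add: o_def continuous_map_pairedI circle_top_def)

lemma in_topspace: "g \<in> sphere 0 1 \<Longrightarrow> z \<in> topspace X \<Longrightarrow> \<Phi> (g, z) \<in> topspace X"
  using continuous_slice continuous_map_image_subset_topspace by blast

lemma stabilizer_power:
  assumes "g \<in> sphere 0 1" "z \<in> topspace X" "\<Phi> (g, z) = z"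
  shows "\<Phi> (g ^ k, z) = z"
  using assms by (induction k) (auto simp: one mult norm_power)

lemma stabilizer_inverse:
  assumes "g \<in> sphere 0 1" "z \<in> topspace X" "\<Phi> (g, z) = z"
  shows "\<Phi> (inverse g, z) = z"
proof -
  have "g \<noteq> 0" using assms(1) by auto
  thus ?thesis
    using mult[of "inverse g" g z] assms by (simp add: one norm_inverse)
qed

definition ineffective :: "complex set"
  where "ineffective = {g \<in> sphere 0 1. \<forall>z\<in>topspace X. \<Phi> (g, z) = z}"

text \<open>
  The property of smooth actions on connected manifolds through which smoothness enters: once it is
  known, the fixed points and the sections of the stabilizers are found by topology alone.
\<close>
definition rigid :: bool
  where "rigid \<longleftrightarrow> (\<forall>g\<in>sphere 0 1. \<forall>n>0. g ^ n = 1 \<longrightarrow>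
    X interior_of {z \<in> topspace X. \<Phi> (g, z) = z} \<noteq> {} \<longrightarrow> g \<in> ineffective)"

text \<open>
  Choose \<open>h = cis s\<close> moving \<open>z\<close>, and disjoint neighbourhoods \<open>V\<close> of \<open>z\<close> and \<open>V'\<close> of \<open>\<Phi> (h, z)\<close>. By
  continuity, \<open>\<Phi> (cis t, x) \<in> V'\<close> for \<open>t\<close> within \<open>\<delta>\<close> of \<open>s\<close> and \<open>x\<close> near \<open>z\<close>. If \<open>x\<close> were stabilized by
  a \<open>g \<noteq> 1\<close> with argument less than \<open>\<delta>\<close>, some power of \<open>g\<close> or \<open>inverse g\<close> would have its argument within
  \<open>\<delta>\<close> of \<open>s\<close> and would move \<open>x \<in> V\<close> into \<open>V'\<close>.
\<close>
lemma no_small_stabilizers: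
  assumes z: "z \<in> topspace X" "z \<notin> fixed_points X \<Phi>"
  obtains \<epsilon> U where "\<epsilon> > 0" "openin X U" "z \<in> U"
    "\<And>x g. x \<in> U \<Longrightarrow> g \<in> sphere 0 1 \<Longrightarrow> \<Phi> (g, x) = x \<Longrightarrow> dist g 1 < \<epsilon> \<Longrightarrow> g = 1"
proof -
  obtain h where h: "h \<in> sphere 0 1" "\<Phi> (h, z) \<noteq> z"
    using z unfolding fixed_points_def circle_group_def by auto
  define s where "s = Arg2pi h"
  have s: "cis s = h" "s \<ge> 0"
    using h(1) Arg2pi_eq[of h] unfolding s_def
    by (auto simp: cis_conv_exp Arg2pi_ge_0 mult.commute)
  obtain V V' where V: "openin X V" "openin X V'" "z \<in> V" "\<Phi> (h, z) \<in> V'" "disjnt V V'"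
    using Hausdorff in_topspace[OF h(1) z(1)] z(1) h(2) unfolding Hausdorff_space_def by metis
  have "continuous_map (prod_topology euclideanreal X) (prod_topology circle_top X) (\<lambda>(t, x). (cis t, x))"
    unfolding circle_top_def
    by (auto simp: continuous_map_pairwise o_def case_prod_unfold continuous_map_in_subtopology
          intro!: continuous_map_snd continuous_map_compose[OF continuous_map_fst, unfolded o_def])
       (auto intro!: continuous_intros)
  from continuous_map_compose[OF this continuous]
  have "continuous_map (prod_topology euclideanreal X) X (\<lambda>(t, x). \<Phi> (cis t, x))"
    by (simp add: o_def case_prod_unfold)
  from openin_continuous_map_preimage[OF this V(2)]
  have "openin (prod_topology euclideanreal X) {p \<in> UNIV \<times> topspace X. \<Phi> (cis (fst p), snd p) \<in> V'}"
    by (simp add: case_prod_unfold)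
  hence "\<exists>T W. openin euclideanreal T \<and> openin X W \<and> s \<in> T \<and> z \<in> W \<and>
      T \<times> W \<subseteq> {p \<in> UNIV \<times> topspace X. \<Phi> (cis (fst p), snd p) \<in> V'}"
    unfolding openin_prod_topology_alt by - (drule spec[of _ s], drule spec[of _ z], use s V z in simp)
  then obtain T W where T: "open T" "s \<in> T" and W: "openin X W" "z \<in> W"
    and TW: "T \<times> W \<subseteq> {p \<in> UNIV \<times> topspace X. \<Phi> (cis (fst p), snd p) \<in> V'}"
    by (auto simp: open_openin[symmetric])
  obtain \<delta> where \<delta>: "\<delta> > 0" "\<And>t. \<bar>t - s\<bar> < \<delta> \<Longrightarrow> t \<in> T"
    using T unfolding open_real_def by (metis T(1) open_dist dist_real_def)
  have "isCont Arg 1"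
    by (rule continuous_at_Arg) (auto simp: complex_nonpos_Reals_iff)
  then obtain \<epsilon> where \<epsilon>: "\<epsilon> > 0" "\<And>g. dist g 1 < \<epsilon> \<Longrightarrow> \<bar>Arg g\<bar> < \<delta>"
    using \<delta>(1) unfolding continuous_at_eps_delta by (force simp: dist_norm)
  show ?thesis
  proof (rule that[OF \<epsilon>(1), of "V \<inter> W"])
    fix x g
    assume x: "x \<in> V \<inter> W" and g: "g \<in> sphere 0 1" "\<Phi> (g, x) = x" "dist g 1 < \<epsilon>"
    have xX: "x \<in> topspace X"
      using x V openin_subset by blast
    show "g = 1"
    proof (rule ccontr)
      assume "g \<noteq> 1"
      \<comment> \<open>Passing to the inverse of \<open>g\<close> if its argument is negative, natural powers suffice, as \<open>s \<ge> 0\<close>.\<close>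
      define t where "t = \<bar>Arg g\<bar>"
      have cisArg: "cis (Arg g) = g"
        using g(1) by (rule cis_Arg_sphere)
      hence t: "0 < t" "t < \<delta>"
        using \<open>g \<noteq> 1\<close> \<epsilon>(2)[OF g(3)] by (auto simp: t_def)
      have "cis t = g \<or> cis t = inverse g"
        using cisArg by (auto simp: t_def abs_if cis_inverse[symmetric] simp del: cis_inverse)
      hence "\<Phi> (cis t, x) = x"
        using stabilizer_inverse[OF g(1) xX g(2)] g(2) by auto
      hence stab: "\<Phi> (cis (real k * t), x) = x" for k :: nat
        using stabilizer_power[of "cis t" x k] xX unfolding Complex.DeMoivre[symmetric] by simp
      define k where "k = nat \<lfloor>s / t\<rfloor>"
      have "real k = of_int \<lfloor>s / t\<rfloor>"
        using s(2) t(1) by (simp add: k_def)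
      hence "real k \<le> s / t" "s / t < real k + 1"
        by linarith+
      hence "\<bar>real k * t - s\<bar> < \<delta>"
        using t by (simp add: field_simps abs_if)
      hence "x \<in> V'"
        using \<delta>(2) TW stab x by fastforce
      thus False
        using x V(5) by (auto simp: disjnt_iff)
    qed
  qed (use V W in auto)
qed

text \<open>
  By compactness two powers \<open>g\<^sup>i\<close> and \<open>g\<^sup>j\<close> are close; then their quotient is close to \<open>1\<close> and stabilizes \<open>z\<close>.
\<close>
lemma stabilizer_finite_order:
  assumes z: "z \<in> topspace X" "z \<notin> fixed_points X \<Phi>" and g: "g \<in> sphere 0 1" "\<Phi> (g, z) = z"
  obtains n :: nat where "n > 0" "g ^ n = 1"
proof -
  obtain \<epsilon> U where U: "\<epsilon> > 0" "z \<in> U"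
    "\<And>x g. x \<in> U \<Longrightarrow> g \<in> sphere 0 1 \<Longrightarrow> \<Phi> (g, x) = x \<Longrightarrow> dist g 1 < \<epsilon> \<Longrightarrow> g = 1"
    using no_small_stabilizers[OF z] by metis
  have "\<forall>k. g ^ k \<in> sphere 0 1"
    using g(1) by (simp add: norm_power)
  then obtain l r where lr: "strict_mono r" "((\<lambda>k. g ^ k) \<circ> r) \<longlonglongrightarrow> l"
    using compact_sphere[of "0::complex" 1] unfolding compact_def by blast
  hence "Cauchy ((\<lambda>k. g ^ k) \<circ> r)"
    using LIMSEQ_imp_Cauchy by blast
  then obtain N where N: "\<And>i j. i \<ge> N \<Longrightarrow> j \<ge> N \<Longrightarrow> dist (g ^ r i) (g ^ r j) < \<epsilon>"
    using U(1) unfolding Cauchy_def by force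
  define n where "n = r (Suc N) - r N"
  have n: "n > 0" "r (Suc N) = r N + n"
    using strict_monoD[OF lr(1), of N "Suc N"] by (auto simp: n_def)
  have "dist (g ^ r (Suc N)) (g ^ r N) = norm (g ^ r N * (g ^ n - 1))"
    by (simp add: n(2) power_add dist_norm algebra_simps)
  also have "\<dots> = dist (g ^ n) 1"
    using g(1) by (simp add: norm_mult norm_power dist_norm)
  finally have "dist (g ^ n) 1 < \<epsilon>"
    using N[of "Suc N" N] by simp
  hence "g ^ n = 1"
    using U(3)[OF U(2)] stabilizer_power[OF g(1) z(1) g(2)] g(1) by (simp add: norm_power)
  thus ?thesis using that n(1) by blast
qed

text \<open>
  Near \<open>z\<close>, the power \<open>\<alpha> x ^ n\<close> with \<open>\<alpha> z ^ n = 1\<close> is a stabilizer element close to \<open>1\<close>, hence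
  \<open>1\<close>; and \<open>\<alpha> z\<close> is isolated among the \<open>n\<close>-th roots of unity.
\<close>
lemma stabilizer_section_locally_constant:
  assumes \<alpha>: "continuous_map X circle_top \<alpha>" "\<And>x. x \<in> topspace X \<Longrightarrow> \<Phi> (\<alpha> x, x) = x"
    and z: "z \<in> topspace X" "z \<notin> fixed_points X \<Phi>"
  obtains U where "openin X U" "z \<in> U" "\<And>x. x \<in> U \<Longrightarrow> \<alpha> x = \<alpha> z"
proof -
  have S: "\<alpha> x \<in> sphere 0 1" if "x \<in> topspace X" for x
    using \<alpha>(1) that continuous_map_image_subset_topspace unfolding circle_top_def by fastforce
  obtain \<epsilon> U where U: "\<epsilon> > 0" "openin X U" "z \<in> U"
    "\<And>x g. x \<in> U \<Longrightarrow> g \<in> sphere 0 1 \<Longrightarrow> \<Phi> (g, x) = x \<Longrightarrow> dist g 1 < \<epsilon> \<Longrightarrow> g = 1"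
    using no_small_stabilizers[OF z] by metis
  obtain n where n: "n > 0" "\<alpha> z ^ n = 1"
    using stabilizer_finite_order[OF z S[OF z(1)] \<alpha>(2)[OF z(1)]] .
  obtain \<delta> where \<delta>: "\<delta> > 0" "\<And>w::complex. w ^ n = 1 \<Longrightarrow> w \<noteq> \<alpha> z \<Longrightarrow> \<delta> \<le> dist (\<alpha> z) w"
    using finite_set_avoid[OF finite_roots_unity[of n, where 'a = complex], of "\<alpha> z"] n(1) by auto
  have open_pre: "openin X {x \<in> topspace X. \<alpha> x \<in> T}" if "open T" for T
  proof -
    have "continuous_map X euclidean \<alpha>"
      using \<alpha>(1) unfolding circle_top_def by (simp add: continuous_map_in_subtopology)
    thus ?thesis
      using openin_continuous_map_preimage[of X euclidean \<alpha> T] that by simp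
  qed
  have "open {w::complex. dist (w ^ n) 1 < \<epsilon>}" "open {w. dist (\<alpha> z) w < \<delta>}"
    by (intro open_Collect_less continuous_intros)+
  note opens = this[THEN open_pre]
  show ?thesis
  proof (rule that)
    show "openin X (U \<inter> ({x \<in> topspace X. \<alpha> x \<in> {w. dist (w ^ n) 1 < \<epsilon>}} \<inter>
        {x \<in> topspace X. \<alpha> x \<in> {w. dist (\<alpha> z) w < \<delta>}}))" (is "openin X ?N")
      using opens U(2) by blast
    show "z \<in> ?N"
      using z U n \<delta> by simp
    fix x assume x: "x \<in> ?N"
    hence xX: "x \<in> topspace X" by blast
    have "\<Phi> (\<alpha> x ^ n, x) = x"
      using stabilizer_power S \<alpha>(2) xX by blast
    hence "\<alpha> x ^ n = 1"
      using U(4)[of x "\<alpha> x ^ n"] x S[OF xX] by (simp add: norm_power)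
    thus "\<alpha> x = \<alpha> z"
      using \<delta>(2)[of "\<alpha> x"] x by force
  qed
qed

end

section \<open>Elements of finite order\<close>

text \<open>
  The interior \<open>I\<close> of the fixed point set of \<open>g\<close> is closed: at a limit point of \<open>I\<close> the sum over the
  powers of \<open>g\<close>, read in a chart, is \<open>g\<close>-invariant and locally injective. Connectedness does the
  rest.
\<close>
lemma (in circle_action) finite_order_fixes_everything:
  fixes A :: "('a, 'e::banach) chart set"
  assumes M: "smooth_manifold X A" and conn: "connected_space X"
    and act: "smooth_circle_action X A \<Phi>"
    and g: "g \<in> sphere 0 1" and n: "n > 0" "g ^ n = 1"
    and nonempty: "X interior_of {z \<in> topspace X. \<Phi> (g, z) = z} \<noteq> {}"
  shows "g \<in> ineffective"
proof -
  obtain B :: "'e set" where B: "finite B" "span B = UNIV"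
    using M unfolding smooth_manifold_def by blast
  define T where "T = {z \<in> topspace X. \<Phi> (g, z) = z}"
  define I where "I = X interior_of T"
  have I: "openin X I" "I \<subseteq> T"
    unfolding I_def by (auto simp: interior_of_subset)
  have clT: "closedin X T"
    unfolding T_def
    using closedin_continuous_maps_eq[OF Hausdorff continuous_slice[OF g] continuous_map_id] by simp
  have gk: "g ^ k \<in> sphere 0 1" for k
    using g by (simp add: norm_power)
  have T_power: "\<Phi> (g ^ k, w) = w" if "w \<in> T" for k w
    using stabilizer_power[OF g] that by (auto simp: T_def)
  have "z \<in> I" if z: "z \<in> X closure_of I" for z
  proof -
    have zT: "z \<in> T"
      using closure_of_minimal[OF I(2) clT] z by blast
    have zX: "z \<in> topspace X" using zT by (simp add: T_def)
    obtain U \<phi> where c: "(U, \<phi>) \<in> A" "is_chart X (U, \<phi>)" "z \<in> U"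
    proof -
      have "\<forall>c\<in>A. is_chart X c" "z \<in> (\<Union>c\<in>A. fst c)"
        using M zX unfolding smooth_manifold_def by simp_all
      thus ?thesis using that by force
    qed
    have U: "openin X U"
      using c(2) by (simp add: is_chart_def)
    note U = U openin_subset[OF U]
    have inj: "inj_on \<phi> U"
      using c(2) by (rule chart_inj_on)
    define p where "p = \<phi> z"
    \<comment> \<open>The \<open>k\<close>-th power of \<open>g\<close> in the chart, and the open set on which this makes sense.\<close>
    define f where "f = (\<lambda>k x. \<phi> (\<Phi> (g ^ k, inv_into U \<phi> x)))"
    define S where "S = (\<lambda>k. \<phi> ` (U \<inter> (\<lambda>z. \<Phi> (g ^ k, z)) -` U))"
    have openS: "open (S k)" for k
    proof -
      have "openin X (U \<inter> {z \<in> topspace X. \<Phi> (g ^ k, z) \<in> U})"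
        using openin_continuous_map_preimage[OF continuous_slice[OF gk] U(1)] U(1) by blast
      moreover have "U \<inter> {z \<in> topspace X. \<Phi> (g ^ k, z) \<in> U} = U \<inter> (\<lambda>z. \<Phi> (g ^ k, z)) -` U"
        using U(2) by auto
      ultimately show ?thesis
        unfolding S_def using chart_open_image[OF c(2)] by auto
    qed
    have pS: "p \<in> S k" for k
      using c(3) T_power[OF zT] by (auto simp: S_def p_def)
    have C1: "Ck_on (Suc 0) (S k) (f k)" for k
      unfolding S_def f_def by (rule slice_C1[OF act gk c(1,2)])
    define I' where "I' = \<phi> ` (U \<inter> I)"
    have openI': "open I'"
      unfolding I'_def using chart_open_image[OF c(2)] U(1) I(1) by blast
    have I'S: "I' \<subseteq> S k" for k
      using T_power I(2) by (fastforce simp: I'_def S_def)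
    have der_I': "frechet_derivative (f k) (at x) v = v" if x: "x \<in> I'" for k x v
    proof -
      have "(f k has_derivative (\<lambda>v. v)) (at x)"
      proof (rule has_derivative_transform_within_open[OF has_derivative_ident openI' x])
        fix y assume "y \<in> I'"
        thus "y = f k y"
          using T_power I(2) inv_into_f_f[OF inj] by (auto simp: I'_def f_def)
      qed
      from frechet_derivative_at[OF this] show ?thesis by metis
    qed
    \<comment> \<open>A derivative different from \<open>id\<close> at \<open>p\<close> would stay so on a neighbourhood, which meets \<open>I'\<close>.\<close>
    have der_p: "frechet_derivative (f k) (at p) v = v" for k v
    proof (rule ccontr)
      assume neq: "frechet_derivative (f k) (at p) v \<noteq> v"
      define W where "W = S k \<inter> (\<lambda>x. frechet_derivative (f k) (at x) v) -` (- {v})"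
      have "continuous_on (S k) (\<lambda>x. frechet_derivative (f k) (at x) v)"
        using C1 by simp
      hence "open W"
        unfolding W_def using openS continuous_open_preimage[of "S k"] by blast
      hence "openin X {w \<in> U. \<phi> w \<in> W}"
        by (rule chart_open_preimage[OF c(2)])
      moreover have "z \<in> {w \<in> U. \<phi> w \<in> W}"
        using c(3) neq pS by (simp add: W_def p_def)
      ultimately have "\<exists>w\<in>I. w \<in> {w \<in> U. \<phi> w \<in> W}"
        using z[unfolded in_closure_of] by meson
      then obtain w where w: "w \<in> I" "w \<in> U" "\<phi> w \<in> W"
        by auto
      hence "\<phi> w \<in> I'"
        by (simp add: I'_def)
      thus False
        using der_I'[of "\<phi> w" k v] w(3) by (simp add: W_def)
    qed
    obtain r where r: "r > 0" "inj_on (\<lambda>x. \<Sum>k<n. f k x) (ball p r)"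
      using sum_locally_injective[where S = S and f = f and p = p, OF B n(1) openS pS C1 der_p] by blast
    define Q where "Q = {w \<in> U. \<phi> w \<in> ball p r}"
    have Q: "openin X Q" "z \<in> Q"
      unfolding Q_def using chart_open_preimage[OF c(2) open_ball] c(3) r(1) by (auto simp: p_def)
    define N where "N = Q \<inter> {w \<in> topspace X. \<Phi> (g, w) \<in> Q}"
    have "openin X N"
      unfolding N_def using openin_continuous_map_preimage[OF continuous_slice[OF g] Q(1)] Q(1) by blast
    moreover have "z \<in> N"
      using Q(2) zT by (simp add: N_def T_def)
    moreover have "N \<subseteq> T"
    proof
      fix w assume w: "w \<in> N"
      hence wX: "w \<in> topspace X" and wU: "w \<in> U" "\<Phi> (g, w) \<in> U"
        and ball: "\<phi> w \<in> ball p r" "\<phi> (\<Phi> (g, w)) \<in> ball p r"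
        by (auto simp: N_def Q_def)
      \<comment> \<open>Invariance of the sum: applying \<open>g\<close> shifts the index, and \<open>g ^ n = 1\<close> closes the cycle.\<close>
      have "(\<Sum>k<n. f k (\<phi> (\<Phi> (g, w)))) = (\<Sum>k<n. \<phi> (\<Phi> (g ^ Suc k, w)))"
        using wU inj mult[OF gk g wX] by (intro sum.cong) (simp_all add: f_def mult.commute)
      also have "\<dots> = (\<Sum>k<n. \<phi> (\<Phi> (g ^ k, w)))"
        using sum.lessThan_Suc_shift[of "\<lambda>k. \<phi> (\<Phi> (g ^ k, w))" n] n(2)
        by (simp add: add.commute)
      also have "\<dots> = (\<Sum>k<n. f k (\<phi> w))"
        using wU inj by (simp add: f_def)
      finally have "\<phi> (\<Phi> (g, w)) = \<phi> w"
        using inj_onD[OF r(2) _ ball(2,1)] by blast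
      thus "w \<in> T"
        using inj_onD[OF inj] wU wX by (auto simp: T_def)
    qed
    ultimately show "z \<in> I"
      unfolding I_def interior_of_def by blast
  qed
  hence "closedin X I"
    using closure_of_subset_eq[of I X] I openin_subset[OF I(1)] by blast
  hence "I = topspace X"
    using conn I(1) nonempty unfolding connected_space_clopen_in I_def T_def by blast
  thus ?thesis
    using I(2) g by (auto simp: ineffective_def T_def)
qed

section \<open>Fixed points and stabilizer sections of a rigid action\<close>

context circle_action
begin

text \<open>
  Two elements of the kernel closer than \<open>\<epsilon>\<close> have a quotient which stabilizes \<open>z\<close> and is too close to
  \<open>1\<close>; so the kernel is a uniformly discrete subset of a compact set.
\<close>
lemma ineffective_finite:
  assumes "z \<in> topspace X" "z \<notin> fixed_points X \<Phi>"
  shows "finite ineffective"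
proof -
  obtain \<epsilon> U where U: "\<epsilon> > 0" "z \<in> U"
    "\<And>x g. x \<in> U \<Longrightarrow> g \<in> sphere 0 1 \<Longrightarrow> \<Phi> (g, x) = x \<Longrightarrow> dist g 1 < \<epsilon> \<Longrightarrow> g = 1"
    using no_small_stabilizers[OF assms] by metis
  have sep: "a = b" if ab: "a \<in> ineffective" "b \<in> ineffective" "dist a b < \<epsilon>" for a b
  proof -
    have b: "norm a = 1" "norm b = 1" "b \<noteq> 0"
      using ab by (auto simp: ineffective_def)
    have "dist (inverse b * a) 1 = norm (inverse b * (a - b))"
      using b by (simp add: dist_norm algebra_simps)
    also have "\<dots> = dist a b"
      using b by (simp add: norm_mult norm_inverse dist_norm)
    finally have "dist (inverse b * a) 1 < \<epsilon>"
      using ab(3) by simp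
    moreover have "\<Phi> (inverse b * a, z) = z"
      using mult[of "inverse b" a z] stabilizer_inverse[of b z] ab assms(1) b
      by (simp add: ineffective_def norm_inverse)
    ultimately have "inverse b * a = 1"
      using U(3)[OF U(2)] b by (simp add: norm_mult norm_inverse)
    thus "a = b"
      using b(3) by (simp add: field_simps)
  qed
  show ?thesis
  proof (rule ccontr)
    assume "infinite ineffective"
    then obtain s :: "nat \<Rightarrow> complex" where s: "inj s" "range s \<subseteq> ineffective"
      using infinite_countable_subset by blast
    hence "\<forall>k. s k \<in> sphere 0 1"
      by (auto simp: ineffective_def)
    then obtain l r where lr: "strict_mono r" "(s \<circ> r) \<longlonglongrightarrow> l"
      using compact_sphere[of "0::complex" 1] unfolding compact_def by blast
    hence "Cauchy (s \<circ> r)"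
      using LIMSEQ_imp_Cauchy by blast
    then obtain N where "\<And>i j. i \<ge> N \<Longrightarrow> j \<ge> N \<Longrightarrow> dist (s (r i)) (s (r j)) < \<epsilon>"
      using U(1) unfolding Cauchy_def by force
    hence "s (r N) = s (r (Suc N))"
      using sep s(2) by (meson le_SucI le_refl range_subsetD)
    thus False
      using s(1) strict_monoD[OF lr(1), of N "Suc N"] by (auto dest: injD)
  qed
qed

text \<open>
  Otherwise rigidity would put the \<open>n\<close>-th roots of unity into the finite kernel for every \<open>n\<close>.
\<close>
lemma fixed_interior_empty:
  assumes z: "z \<in> topspace X" "z \<notin> fixed_points X \<Phi>"
    and rigid: rigid
  shows "X interior_of fixed_points X \<Phi> = {}"
proof (rule ccontr)
  assume ne: "X interior_of fixed_points X \<Phi> \<noteq> {}"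
  have "{w. w ^ n = 1} \<subseteq> ineffective" if "n > 0" for n
  proof
    fix w :: complex assume "w \<in> {w. w ^ n = 1}"
    hence w: "w ^ n = 1" by simp
    hence "norm w ^ n = 1 ^ n"
      by (metis norm_one norm_power power_one)
    hence "norm w = 1"
      using power_eq_imp_eq_base[OF _ norm_ge_zero zero_le_one that] by blast
    hence sph: "w \<in> sphere 0 1" by simp
    have "fixed_points X \<Phi> \<subseteq> {z \<in> topspace X. \<Phi> (w, z) = z}"
      using sph by (auto simp: fixed_points_def circle_group_def)
    hence "X interior_of {z \<in> topspace X. \<Phi> (w, z) = z} \<noteq> {}"
      using ne interior_of_mono by blast
    thus "w \<in> ineffective"
      using rigid sph w that unfolding rigid_def by blast
  qed
  hence "n \<le> card ineffective" if "n > 0" for n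
    using card_mono[OF ineffective_finite[OF z]] card_roots_unity_eq[OF that] that by metis
  from this[of "Suc (card ineffective)"] show False by simp
qed

text \<open>
  The section is constant near \<open>z\<close>, so its value there is of finite order and fixes an open set.
\<close>
lemma stabilizer_section_in_ineffective:
  assumes rigid: rigid
    and \<alpha>: "continuous_map X circle_top \<alpha>" "\<And>x. x \<in> topspace X \<Longrightarrow> \<Phi> (\<alpha> x, x) = x"
    and z: "z \<in> topspace X" "z \<notin> fixed_points X \<Phi>"
  shows "\<alpha> z \<in> ineffective"
proof -
  have S: "\<alpha> z \<in> sphere 0 1"
    using \<alpha>(1) z(1) continuous_map_image_subset_topspace unfolding circle_top_def by fastforce
  obtain n where n: "n > 0" "\<alpha> z ^ n = 1"
    using stabilizer_finite_order[OF z S \<alpha>(2)[OF z(1)]] .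
  obtain U where U: "openin X U" "z \<in> U" "\<And>x. x \<in> U \<Longrightarrow> \<alpha> x = \<alpha> z"
    using stabilizer_section_locally_constant[OF \<alpha> z] by metis
  have "U \<subseteq> {x \<in> topspace X. \<Phi> (\<alpha> z, x) = x}"
  proof
    fix x assume x: "x \<in> U"
    hence "x \<in> topspace X" using openin_subset[OF U(1)] by blast
    thus "x \<in> {x \<in> topspace X. \<Phi> (\<alpha> z, x) = x}"
      using \<alpha>(2)[of x] U(3)[OF x] by simp
  qed
  hence "z \<in> X interior_of {x \<in> topspace X. \<Phi> (\<alpha> z, x) = x}"
    using U unfolding interior_of_def by blast
  thus ?thesis
    using rigid S n unfolding rigid_def by blast
qed

text \<open>
  The values lie in the finite kernel on the dense set of nonfixed points, hence everywhere, and a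
  connected finite set is a point.
\<close>
lemma stabilizer_section_constant:
  assumes conn: "connected_space X" and z0: "z0 \<in> topspace X" "z0 \<notin> fixed_points X \<Phi>"
    and rigid: rigid
    and \<alpha>: "continuous_map X circle_top \<alpha>" "\<And>x. x \<in> topspace X \<Longrightarrow> \<Phi> (\<alpha> x, x) = x"
  obtains k where "k \<in> ineffective" "\<And>x. x \<in> topspace X \<Longrightarrow> \<alpha> x = k"
proof -
  have "closedin circle_top ineffective"
    unfolding circle_top_def using ineffective_finite[OF z0]
    by (intro closed_subset) (auto simp: ineffective_def finite_imp_closed)
  from closedin_continuous_map_preimage[OF \<alpha>(1) this]
  have "closedin X {x \<in> topspace X. \<alpha> x \<in> ineffective}" .
  moreover have "topspace X - fixed_points X \<Phi> \<subseteq> {x \<in> topspace X. \<alpha> x \<in> ineffective}"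
    using stabilizer_section_in_ineffective[OF rigid \<alpha>] by blast
  ultimately have "X closure_of (topspace X - fixed_points X \<Phi>) \<subseteq> {x \<in> topspace X. \<alpha> x \<in> ineffective}"
    by (rule closure_of_minimal[rotated])
  hence K: "\<alpha> x \<in> ineffective" if "x \<in> topspace X" for x
    using that fixed_interior_empty[OF z0 rigid] unfolding closure_of_complement by blast
  have "connectedin circle_top (\<alpha> ` topspace X)"
    using connectedin_continuous_map_image[OF \<alpha>(1)] conn by (simp add: connectedin_topspace)
  hence "connected (\<alpha> ` topspace X)"
    by (simp add: circle_top_def connectedin_subtopology)
  moreover have "finite (\<alpha> ` topspace X)"
    using K finite_subset[OF _ ineffective_finite[OF z0]] by blast
  ultimately obtain k where "\<alpha> ` topspace X = {k}"
    using connected_finite_iff_sing z0(1) by blast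
  thus ?thesis
    using that[of k] K by (metis image_eqI insertI1 singletonD imageE)
qed

end

section \<open>Finite subgroups of the circle and constant maps\<close>

text \<open>
  Multiplication by \<open>a \<in> K\<close> permutes \<open>K\<close>; comparing the products over \<open>K\<close> gives \<open>a ^ card K = 1\<close>.
  There are exactly \<open>card K\<close> such numbers.
\<close>
lemma finite_mult_closed_eq_roots_unity:
  fixes K :: "complex set"
  assumes fin: "finite K" and one: "1 \<in> K" and zero: "0 \<notin> K"
    and mult: "\<And>a b. a \<in> K \<Longrightarrow> b \<in> K \<Longrightarrow> a * b \<in> K"
  shows "K = {z. z ^ card K = 1}"
proof -
  have pos: "card K > 0"
    using fin one card_gt_0_iff by blast
  have "a ^ card K = 1" if a: "a \<in> K" for a
  proof -
    have inj: "inj_on ((*) a) K"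
      using a zero by (auto simp: inj_on_def)
    have "(*) a ` K = K"
      using mult a by (intro card_subset_eq[OF fin]) (auto simp: card_image[OF inj])
    hence "\<Prod>K = (\<Prod>x\<in>K. a * x)"
      using prod.reindex[OF inj, of "\<lambda>x. x"] by simp
    also have "\<dots> = a ^ card K * \<Prod>K"
      by (simp add: prod.distrib)
    finally show ?thesis
      using zero fin by (simp add: prod_zero_iff)
  qed
  thus ?thesis
    using pos by (intro card_subset_eq) (auto simp: finite_roots_unity card_roots_unity_eq)
qed

context circle_action
begin

lemma ineffectivity_kernel_eq: "ineffectivity_kernel X A \<Phi> = ineffective"
proof -
  have "(\<lambda>z\<in>topspace X. \<Phi> (g, z)) = (\<lambda>z\<in>topspace X. z) \<longleftrightarrow> (\<forall>z\<in>topspace X. \<Phi> (g, z) = z)" for g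
    by (auto simp: restrict_def fun_eq_iff)
  thus ?thesis
    by (auto simp: ineffectivity_kernel_def ineffective_def kernel_def Diff_group_def BijGroup_def circle_group_def)
qed

lemma group_ineffective: "group (circle_group\<lparr>carrier := ineffective\<rparr>)"
proof (rule groupI)
  fix a b
  assume "a \<in> carrier (circle_group\<lparr>carrier := ineffective\<rparr>)" "b \<in> carrier (circle_group\<lparr>carrier := ineffective\<rparr>)"
  thus "a \<otimes>\<^bsub>circle_group\<lparr>carrier := ineffective\<rparr>\<^esub> b \<in> carrier (circle_group\<lparr>carrier := ineffective\<rparr>)"
    by (auto simp: circle_group_def ineffective_def norm_mult mult)
next
  fix a
  assume "a \<in> carrier (circle_group\<lparr>carrier := ineffective\<rparr>)"
  hence a: "a \<in> ineffective" by simp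
  hence "a \<noteq> 0" by (auto simp: ineffective_def)
  moreover have "inverse a \<in> ineffective"
    using a stabilizer_inverse by (auto simp: ineffective_def norm_inverse)
  ultimately show "\<exists>b\<in>carrier (circle_group\<lparr>carrier := ineffective\<rparr>).
      b \<otimes>\<^bsub>circle_group\<lparr>carrier := ineffective\<rparr>\<^esub> a = \<one>\<^bsub>circle_group\<lparr>carrier := ineffective\<rparr>\<^esub>"
    by (auto simp: circle_group_def intro!: bexI[of _ "inverse a"])
qed (auto simp: circle_group_def ineffective_def one mult.assoc)

end

lemma constant_in_smooth_circle_maps:
  fixes A :: "('a, 'e::banach) chart set"
  assumes M: "smooth_manifold X A" and k: "k \<in> sphere 0 1"
  shows "(\<lambda>z\<in>topspace X. k) \<in> carrier (smooth_circle_maps X A)"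
proof -
  let ?f = "\<lambda>z\<in>topspace X. k"
  have "continuous_map X circle_top (\<lambda>z. k)"
    using k by (simp add: circle_top_def)
  hence "continuous_map X circle_top ?f"
    by (rule continuous_map_eq) simp
  moreover have "smooth_on (\<phi> ` (U \<inter> ?f -` V)) (\<psi> \<circ> ?f \<circ> inv_into U \<phi>)"
    if "(U, \<phi>) \<in> A" for U \<phi> and V :: "complex set" and \<psi> :: "complex \<Rightarrow> real"
  proof -
    have c: "is_chart X (U, \<phi>)"
      using M that unfolding smooth_manifold_def by blast
    have U: "openin X U"
      using c by (simp add: is_chart_def)
    note UX = openin_subset[OF U]
    have "U \<inter> ?f -` V = (if k \<in> V then U else {})"
      using UX by auto
    hence "open (\<phi> ` (U \<inter> ?f -` V))"
      using c by (simp add: is_chart_def)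
    moreover have "(\<psi> \<circ> ?f \<circ> inv_into U \<phi>) x = \<psi> k" if "x \<in> \<phi> ` (U \<inter> ?f -` V)" for x
    proof -
      have "inv_into U \<phi> x \<in> topspace X"
        using that UX inv_into_into[of x \<phi> U] by blast
      thus ?thesis by simp
    qed
    ultimately show ?thesis
      unfolding smooth_on_def using Ck_on_constant by blast
  qed
  ultimately show ?thesis
    unfolding smooth_circle_maps_def smooth_map_def by auto
qed

lemma roots_unity_cyclic:
  assumes grp: "group (circle_group\<lparr>carrier := {z. z ^ n = 1}\<rparr>)" and n: "n > 0"
  shows "cyclic_group (circle_group\<lparr>carrier := {z. z ^ n = 1}\<rparr>)"
proof -
  let ?G = "circle_group\<lparr>carrier := {z. z ^ n = 1}\<rparr>"
  interpret group ?G by (rule grp)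
  define w where "w = cis (2 * pi / real n)"
  have w: "w \<in> carrier ?G"
    using n unfolding w_def by (simp add: Complex.DeMoivre)
  have pow: "w [^]\<^bsub>?G\<^esub> k = w ^ k" for k :: nat
    by (induction k) (simp_all add: circle_group_def)
  have "z \<in> range (\<lambda>i::int. w [^]\<^bsub>?G\<^esub> i)" if "z \<in> carrier ?G" for z
  proof -
    have "z \<in> (\<lambda>k. cis (2 * pi * real k / real n)) ` {..<n}"
      using that bij_betw_imp_surj_on[OF Complex.bij_betw_roots_unity[OF n]] by simp
    then obtain k where "z = cis (2 * pi * real k / real n)"
      by blast
    hence "z = w ^ k"
      unfolding w_def Complex.DeMoivre by (simp add: mult_ac)
    hence "z = w [^]\<^bsub>?G\<^esub> int k"
      using pow by (simp add: int_pow_int)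
    thus ?thesis by blast
  qed
  hence "carrier ?G = range (\<lambda>i::int. w [^]\<^bsub>?G\<^esub> i)"
    using int_pow_closed[OF w] by blast
  thus ?thesis
    using w cyclic_group by blast
qed

section \<open>Sections of the stabilizers of a smooth action\<close>

theorem theorem1p2:
  fixes X :: "'a topology" and A :: "('a, 'e::banach) chart set"
    and \<Phi> :: "complex \<times> 'a \<Rightarrow> 'a"
  assumes "smooth_manifold X A" and "connected_space X"
    and "smooth_circle_action X A \<Phi>"
    and "\<not> trivial_action X \<Phi>"
  shows "X interior_of fixed_points X \<Phi> = {} \<and>
     Z_id X A \<Phi> = {\<lambda>z\<in>topspace X. k | k. k \<in> ineffectivity_kernel X A \<Phi>} \<and>
     smooth_circle_maps X A \<lparr>carrier := Z_id X A \<Phi>\<rparr>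
       \<cong> circle_group \<lparr>carrier := ineffectivity_kernel X A \<Phi>\<rparr> \<and>
     group (smooth_circle_maps X A \<lparr>carrier := Z_id X A \<Phi>\<rparr>) \<and>
     cyclic_group (smooth_circle_maps X A \<lparr>carrier := Z_id X A \<Phi>\<rparr>) \<and>
     finite (Z_id X A \<Phi>)"
proof -
  interpret circle_action X \<Phi>
    using assms(1,3)
    by unfold_locales
       (simp_all add: smooth_manifold_def smooth_circle_action_def smooth_map_def circle_group_def)
  define K where "K = ineffective"
  define Z where "Z = Z_id X A \<Phi>"
  let ?ZG = "smooth_circle_maps X A\<lparr>carrier := Z\<rparr>"
  let ?KG = "circle_group\<lparr>carrier := K\<rparr>"
  have rig: rigid
    unfolding rigid_def using finite_order_fixes_everything[OF assms(1-3)] by blast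
  obtain z0 where z0: "z0 \<in> topspace X" "z0 \<notin> fixed_points X \<Phi>"
    using assms(4) by (auto simp: trivial_action_def)
  have Ksphere: "K \<subseteq> sphere 0 1"
    by (auto simp: K_def ineffective_def)
  have Zeq: "Z = (\<lambda>k. \<lambda>z\<in>topspace X. k) ` K"
  proof (intro equalityI subsetI)
    fix \<alpha> assume \<alpha>: "\<alpha> \<in> Z"
    hence "continuous_map X circle_top \<alpha>" "\<And>x. x \<in> topspace X \<Longrightarrow> \<Phi> (\<alpha> x, x) = x"
      and ext: "\<alpha> \<in> extensional (topspace X)"
      by (auto simp: Z_def Z_id_def smooth_circle_maps_def smooth_map_def)
    then obtain k where k: "k \<in> K" "\<And>x. x \<in> topspace X \<Longrightarrow> \<alpha> x = k"
      using stabilizer_section_constant[OF assms(2) z0 rig] unfolding K_def by metis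
    have "\<alpha> = (\<lambda>z\<in>topspace X. k)"
      using ext k(2) by (intro extensionalityI[of _ "topspace X"]) auto
    thus "\<alpha> \<in> (\<lambda>k. \<lambda>z\<in>topspace X. k) ` K"
      using k(1) by blast
  next
    fix \<alpha> assume "\<alpha> \<in> (\<lambda>k. \<lambda>z\<in>topspace X. k) ` K"
    then obtain k where k: "k \<in> K" "\<alpha> = (\<lambda>z\<in>topspace X. k)"
      by blast
    moreover have "\<alpha> \<in> carrier (smooth_circle_maps X A)"
      unfolding k(2) by (rule constant_in_smooth_circle_maps[OF assms(1)]) (use k Ksphere in blast)
    ultimately show "\<alpha> \<in> Z"
      by (simp add: Z_def Z_id_def K_def ineffective_def)
  qed
  have grpK: "group ?KG"
    unfolding K_def by (rule group_ineffective)
  have finK: "finite K"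
    unfolding K_def by (rule ineffective_finite[OF z0])
  have Kprops: "1 \<in> K" "0 \<notin> K" "\<And>a b. a \<in> K \<Longrightarrow> b \<in> K \<Longrightarrow> a * b \<in> K"
    using group.is_monoid[OF grpK, THEN monoid.one_closed] Ksphere
      group.is_monoid[OF grpK, THEN monoid.m_closed]
    by (auto simp: circle_group_def)
  have cycK: "cyclic_group ?KG"
  proof -
    have eq: "K = {z. z ^ card K = 1}"
      using finite_mult_closed_eq_roots_unity[OF finK Kprops] .
    have "card K > 0"
      using finK Kprops(1) card_gt_0_iff by blast
    from roots_unity_cyclic[OF _ this] show ?thesis
      using grpK unfolding eq[symmetric] by blast
  qed
  have iso: "(\<lambda>k. \<lambda>z\<in>topspace X. k) \<in> iso ?KG ?ZG"
  proof -
    have "inj_on (\<lambda>k. \<lambda>z\<in>topspace X. k) K"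
      using z0(1) by (auto simp: inj_on_def restrict_def fun_eq_iff)
    thus ?thesis
      unfolding iso_def hom_def bij_betw_def
      by (auto simp: Zeq circle_group_def smooth_circle_maps_def restrict_def fun_eq_iff)
  qed
  have "monoid ?ZG"
    by (rule monoidI)
       (auto simp: Zeq smooth_circle_maps_def restrict_def fun_eq_iff mult_ac Kprops intro!: image_eqI)
  hence grpZ: "group ?ZG"
    using group.iso_imp_group[OF grpK] iso by (auto simp: is_iso_def)
  have "?ZG \<cong> ?KG"
    using group.iso_sym[OF grpK] iso by (auto simp: is_iso_def)
  moreover from this have "cyclic_group ?ZG"
    using isomorphic_group_cyclicity[OF _ grpZ grpK] cycK by blast
  moreover have "finite Z"
    unfolding Zeq using finK by blast
  moreover have "Z = {\<lambda>z\<in>topspace X. k | k. k \<in> K}"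
    unfolding Zeq by blast
  ultimately show ?thesis
    using fixed_interior_empty[OF z0 rig] grpZ
    unfolding ineffectivity_kernel_eq Z_def K_def by blast
qed

end
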